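(* For given $d\ge 2$, $\eta>0$ and $0<m\le M$ there exist positive constants $K_3,K_4,C_6,C_7$, depending only on $d,\eta,m,M$, such that for every $F\in\mathcal P_d$ forming an $(h,\kappa,\eta,m,M)$-regular cluster: 1. For each positive $\epsilon\le C_6h^{2d-1}$, $$K_3\left(\frac1{(1+|\kappa|)h}\right)^{2d-1}h\,\epsilon\le\rho_x(F,\epsilon).$$ 2. For each positive $\epsilon\le C_7h^{2d-1}$, $$K_4\left(\frac1{(1+|\kappa|)h}\right)^{2d-1}\epsilon\le\rho(F,\epsilon)\quad\text{and}\quad K_4\left(\frac1{(1+|\kappa|)h}\right)^{2d-1}\epsilon\le\rho_a(F,\epsilon).$$
   Context: $\mathcal P_d$ is the set of $F=(a,x)\in\mathbb R^d\times\mathbb R^d$ with $x_1<\dots<x_d$ and all $a_j\ne0$; $F$ is identified with $F(x)=\sum_j a_j\delta(x-x_j)$. Moments: $m_k(F)=\sum_{j=1}^d a_jx_j^k$. All norms are maximum norms: $\|F\|=\max(\|a\|,\|x\|)$, $\|v\|=\max_j|v_j|$. Put $h(F)=\frac12(x_d-x_1)$, $\kappa(F)=\frac12(x_1+x_d)$. For $0<m\le M$ and $\eta>0$, $F$ forms an $(h,\kappa,\eta,m,M)$-regular cluster if $h=h(F)\le\frac12$, $\kappa=\kappa(F)$, $m\le|a_j|\le M$ for all $j$, and $x_{j+1}-x_j\ge\eta h$ for $j=1,\dots,d-1$. Error set: $E_\epsilon(F)=\{F'\in\mathcal P_d: |m_k(F')-m_k(F)|\le\epsilon,\ k=0,\dots,2d-1\}$.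 Worst case reconstruction errors of $F=(a,x)$: $\rho(F,\epsilon)=\sup_{F'\in E_\epsilon(F)}\|F'-F\|$, $\rho_a(F,\epsilon)=\sup_{F'=(a',x')\in E_\epsilon(F)}\|a'-a\|$, $\rho_x(F,\epsilon)=\sup_{F'=(a',x')\in E_\epsilon(F)}\|x'-x\|$ (values in $[0,\infty]$). *)

theory Defs
  imports Complex_Main "HOL-Library.Extended_Real" "HOL-Library.FuncSet" "HOL-Library.Product_Plus"
begin

text \<open>
  A vector of \<open>\<real>\<^sup>d\<close> is a function on the index set \<open>{1..d}\<close>, extended by \<open>undefined\<close>.
  A signal \<open>F = (a, x)\<close> consists of its amplitudes \<open>a\<close> and its nodes \<open>x\<close>.
\<close>

type_synonym signal = "(nat \<Rightarrow> real) \<times> (nat \<Rightarrow> real)"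

definition signals :: "nat \<Rightarrow> signal set" where
  "signals d = {(a, x). a \<in> {1..d} \<rightarrow>\<^sub>E UNIV \<and> x \<in> {1..d} \<rightarrow>\<^sub>E UNIV \<and>
     strict_mono_on {1..d} x \<and> (\<forall>j\<in>{1..d}. a j \<noteq> 0)}"

definition moment :: "nat \<Rightarrow> nat \<Rightarrow> signal \<Rightarrow> real" where
  "moment d k F = (\<Sum>j=1..d. fst F j * snd F j ^ k)"

text \<open>The maximum norm needs \<open>d \<ge> 1\<close>: for \<open>d = 0\<close> the set below is empty.\<close>

definition vec_max_norm :: "nat \<Rightarrow> (nat \<Rightarrow> real) \<Rightarrow> real" where
  "vec_max_norm d v = Max ((\<lambda>j. \<bar>v j\<bar>) ` {1..d})"

definition max_norm :: "nat \<Rightarrow> signal \<Rightarrow> real" where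
  "max_norm d F = max (vec_max_norm d (fst F)) (vec_max_norm d (snd F))"

definition cluster_h :: "nat \<Rightarrow> signal \<Rightarrow> real" where
  "cluster_h d F = (snd F d - snd F 1) / 2"

definition cluster_center :: "nat \<Rightarrow> signal \<Rightarrow> real" where
  "cluster_center d F = (snd F 1 + snd F d) / 2"

definition regular_cluster ::
    "nat \<Rightarrow> real \<Rightarrow> real \<Rightarrow> real \<Rightarrow> real \<Rightarrow> real \<Rightarrow> signal \<Rightarrow> bool" where
  "regular_cluster d h \<kappa> \<eta> m M F \<longleftrightarrow>
     h = cluster_h d F \<and> h \<le> 1 / 2 \<and> \<kappa> = cluster_center d F \<and>
     (\<forall>j\<in>{1..d}. m \<le> \<bar>fst F j\<bar> \<and> \<bar>fst F j\<bar> \<le> M) \<and>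
     (\<forall>j\<in>{1..d-1}. snd F (j + 1) - snd F j \<ge> \<eta> * h)"

definition error_set :: "nat \<Rightarrow> real \<Rightarrow> signal \<Rightarrow> signal set" where
  "error_set d \<epsilon> F =
     {F' \<in> signals d. \<forall>k\<in>{0..2*d-1}. \<bar>moment d k F' - moment d k F\<bar> \<le> \<epsilon>}"

text \<open>
  The suprema below may be infinite. For \<open>F \<in> signals d\<close> and \<open>\<epsilon> \<ge> 0\<close> the error set
  contains \<open>F\<close>, so they are then nonnegative. Outside \<open>{1..d}\<close> the pointwise differences
  are meaningless, but the norms ignore those values.
\<close>

definition rho :: "nat \<Rightarrow> signal \<Rightarrow> real \<Rightarrow> ereal" where
  "rho d F \<epsilon> = (SUP F'\<in>error_set d \<epsilon> F. ereal (max_norm d (F' - F)))"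

definition rho_a :: "nat \<Rightarrow> signal \<Rightarrow> real \<Rightarrow> ereal" where
  "rho_a d F \<epsilon> = (SUP F'\<in>error_set d \<epsilon> F. ereal (vec_max_norm d (fst F' - fst F)))"

definition rho_x :: "nat \<Rightarrow> signal \<Rightarrow> real \<Rightarrow> ereal" where
  "rho_x d F \<epsilon> = (SUP F'\<in>error_set d \<epsilon> F. ereal (vec_max_norm d (snd F' - snd F)))"

end

theory Submission imports Defs "HOL-Computational_Algebra.Polynomial" begin

text \<open>
  Move \<open>F\<close> along the curve of signals whose moments of order \<open>0, \<dots>, 2d - 2\<close> agree with those of
  \<open>F\<close>. Its nodes are the roots of \<open>Q + t P\<close>, where \<open>Q\<close> is the monic polynomial with roots
  \<open>x\<^sub>j\<close>, and \<open>P\<close> interpolates \<open>1 / (a\<^sub>j Q'(x\<^sub>j))\<close> at \<open>x\<^sub>j\<close>; the last moment changes by exactly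
  \<open>- t\<close>. With \<open>t = \<epsilon>\<close> this stays in the error set. For small \<open>\<epsilon> / h\<^sup>2\<^sup>d\<^sup>-\<^sup>1\<close> a sign change
  gives a root near each \<open>x\<^sub>j\<close>, and evaluating \<open>Q + t P\<close> at \<open>x\<^sub>1\<close> shows that the first node moves
  by at least a constant times \<open>\<epsilon> / h\<^sup>2\<^sup>d\<^sup>-\<^sup>2\<close>. The first amplitude is then forced to move by at
  least a constant times \<open>1 / h\<close> as much. Since the construction is translation invariant,
  \<open>\<kappa>\<close> enters only through \<open>1 \<le> 1 + \<bar>\<kappa>\<bar>\<close>.
\<close>

section \<open>Node polynomials and Lagrange interpolation\<close>

definition node_poly :: "'i set \<Rightarrow> ('i \<Rightarrow> 'a::field) \<Rightarrow> 'a poly" where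
  "node_poly I x = (\<Prod>i\<in>I. [:- x i, 1:])"

text \<open>For finite \<open>I\<close> containing \<open>j\<close> this is the derivative of
  \<open>node_poly I x\<close> at \<open>x j\<close>, the reciprocal of the barycentric
  weight.\<close>

definition lagrange_weight :: "'i set \<Rightarrow> ('i \<Rightarrow> 'a::field) \<Rightarrow> 'i \<Rightarrow> 'a" where
  "lagrange_weight I x j = poly (node_poly (I - {j}) x) (x j)"

lemma poly_node_poly: "poly (node_poly I x) z = (\<Prod>i\<in>I. z - x i)"
  by (simp add: node_poly_def poly_prod)

lemma degree_node_poly: "degree (node_poly I x) = card I"
  by (simp add: node_poly_def degree_prod_eq_sum_degree)

lemma coeff_node_poly_card: "coeff (node_poly I x) (card I) = 1"
  using lead_coeff_prod[of "\<lambda>i. [:- x i, 1:]" I] 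
  by (simp add: node_poly_def[symmetric] degree_node_poly)

lemma node_poly_nonzero: "node_poly I x \<noteq> 0"
  using coeff_node_poly_card[of I x] by auto

lemma poly_node_poly_node: "finite I \<Longrightarrow> i \<in> I \<Longrightarrow> poly (node_poly I x) (x i) = 0"
  by (auto simp: poly_node_poly)

lemma lagrange_weight_nonzero:
  assumes "finite I" "inj_on x I" "j \<in> I"
  shows "lagrange_weight I x j \<noteq> 0"
  using assms by (auto simp: lagrange_weight_def poly_node_poly inj_on_def)

lemma poly_sum_node_poly:
  assumes "finite I" "i \<in> I"
  shows "poly (\<Sum>j\<in>I. smult (c j) (node_poly (I - {j}) x)) (x i) = c i * lagrange_weight I x i"
proof -
  have "poly (\<Sum>j\<in>I. smult (c j) (node_poly (I - {j}) x)) (x i) =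
      (\<Sum>j\<in>I. if j = i then c i * lagrange_weight I x i else 0)"
    unfolding poly_sum using assms
    by (intro sum.cong) (auto simp: lagrange_weight_def poly_node_poly_node)
  then show ?thesis
    using assms by simp
qed

lemma degree_sum_node_poly:
  assumes "finite I"
  shows "degree (\<Sum>j\<in>I. smult (c j) (node_poly (I - {j}) x)) \<le> card I - 1"
proof (rule degree_sum_le[OF assms])
  fix j assume "j \<in> I"
  then show "degree (smult (c j) (node_poly (I - {j}) x)) \<le> card I - 1"
    using degree_smult_le[of "c j" "node_poly (I - {j}) x"] assms by (simp add: degree_node_poly)
qed

lemma lagrange_interpolation:
  assumes "finite I" "inj_on x I" "degree q < card I"
  shows "q = (\<Sum>j\<in>I. smult (poly q (x j) / lagrange_weight I x j) (node_poly (I - {j}) x))"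
proof (rule poly_eqI_degree[of "x ` I"])
  fix z assume "z \<in> x ` I"
  then show "poly q z = poly (\<Sum>j\<in>I. smult (poly q (x j) / lagrange_weight I x j) (node_poly (I - {j}) x)) z"
    using assms poly_sum_node_poly[OF assms(1), of _ "\<lambda>j. poly q (x j) / lagrange_weight I x j" x]
    by (auto simp: lagrange_weight_nonzero)
next
  show "degree q < card (x ` I)"
    using assms by (simp add: card_image)
  show "degree (\<Sum>j\<in>I. smult (poly q (x j) / lagrange_weight I x j) (node_poly (I - {j}) x)) < card (x ` I)"
    using assms degree_sum_node_poly[OF assms(1), of "\<lambda>j. poly q (x j) / lagrange_weight I x j" x]
    by (simp add: card_image)
qed

text \<open>Compare the coefficients of degree \<open>card I - 1\<close> in the Lagrange formula:
  every \<open>node_poly (I - {j}) x\<close> is monic of that degree.\<close>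

lemma divided_difference_eq_coeff:
  assumes "finite I" "inj_on x I" "degree q < card I"
  shows "(\<Sum>j\<in>I. poly q (x j) / lagrange_weight I x j) = coeff q (card I - 1)"
proof -
  have "coeff (node_poly (I - {j}) x) (card I - 1) = 1" if "j \<in> I" for j
    using coeff_node_poly_card[of "I - {j}" x] that assms(1) by simp
  then have "coeff (\<Sum>j\<in>I. smult (poly q (x j) / lagrange_weight I x j) (node_poly (I - {j}) x)) (card I - 1)
      = (\<Sum>j\<in>I. poly q (x j) / lagrange_weight I x j)"
    by (simp add: coeff_sum)
  then show ?thesis
    using lagrange_interpolation[OF assms] by simp
qed

section \<open>Orthogonality and moments of the perturbed signal\<close>

text \<open>
  The polynomials \<open>node_poly I x + smult t (prony_direction I a x)\<close> are the monic ones of degree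
  \<open>card I\<close> that are orthogonal, for the functional \<open>p \<mapsto> (\<Sum>i\<in>I. a i * p (x i))\<close>, to all
  polynomials of degree at most \<open>card I - 2\<close>.
\<close>

definition prony_direction :: "'i set \<Rightarrow> ('i \<Rightarrow> 'a::field) \<Rightarrow> ('i \<Rightarrow> 'a) \<Rightarrow> 'a poly" where
  "prony_direction I a x =
    (\<Sum>j\<in>I. smult (1 / (a j * (lagrange_weight I x j)\<^sup>2)) (node_poly (I - {j}) x))"

text \<open>One of the two weights in the definition normalizes the Lagrange basis. The one left
  over turns the functional, applied to the direction times \<open>q\<close>, into the divided
  difference of \<open>q\<close>.\<close>

lemma poly_prony_direction_node:
  assumes "finite I" "i \<in> I"
  shows "poly (prony_direction I a x) (x i) = 1 / (a i * lagrange_weight I x i)"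
  unfolding prony_direction_def
  by (subst poly_sum_node_poly[OF assms]) (simp add: power2_eq_square)

text \<open>The functional \<open>p \<mapsto> (\<Sum>i\<in>I. a i * poly p (x i))\<close> applied to
  the Lagrange basis polynomial of the nodes \<open>y\<close> at \<open>j\<close>: the weights of
  interpolatory quadrature.\<close>

definition quadrature_weight :: "'i set \<Rightarrow> ('i \<Rightarrow> 'a::field) \<Rightarrow> ('i \<Rightarrow> 'a) \<Rightarrow> ('i \<Rightarrow> 'a) \<Rightarrow> 'i \<Rightarrow> 'a" where
  "quadrature_weight I a x y j =
    (\<Sum>i\<in>I. a i * poly (node_poly (I - {j}) y) (x i)) / lagrange_weight I y j"

lemma quadrature_low_degree:
  assumes "finite I" "inj_on y I" "degree p < card I"
  shows "(\<Sum>j\<in>I. quadrature_weight I a x y j * poly p (y j)) = (\<Sum>i\<in>I. a i * poly p (x i))"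
proof -
  have "poly p z = (\<Sum>j\<in>I. poly p (y j) / lagrange_weight I y j * poly (node_poly (I - {j}) y) z)" for z
    by (subst lagrange_interpolation[OF assms]) (simp add: poly_sum)
  then have "(\<Sum>i\<in>I. a i * poly p (x i)) =
      (\<Sum>i\<in>I. a i * (\<Sum>j\<in>I. poly p (y j) / lagrange_weight I y j * poly (node_poly (I - {j}) y) (x i)))"
    by metis
  also have "\<dots> = (\<Sum>i\<in>I. \<Sum>j\<in>I. a i * (poly p (y j) / lagrange_weight I y j * poly (node_poly (I - {j}) y) (x i)))"
    by (simp add: sum_distrib_left)
  also have "\<dots> = (\<Sum>j\<in>I. \<Sum>i\<in>I. a i * (poly p (y j) / lagrange_weight I y j * poly (node_poly (I - {j}) y) (x i)))"
    by (rule sum.swap)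
  also have "\<dots> = (\<Sum>j\<in>I. quadrature_weight I a x y j * poly p (y j))"
    by (intro sum.cong) (simp_all add: quadrature_weight_def sum_distrib_left sum_divide_distrib mult_ac)
  finally show ?thesis ..
qed

text \<open>This is the argument of Gauss quadrature: divide \<open>p\<close> by
  \<open>node_poly I y\<close>. The remainder is integrated exactly, and the quotient is seen only
  through its coefficient of degree \<open>card I - 1\<close>, by orthogonality of the new node
  polynomial to lower degrees.\<close>

lemma quadrature_prony_direction:
  fixes a :: "'i \<Rightarrow> 'a::field"
  assumes I: "finite I" and x: "inj_on x I" and y: "inj_on y I" and a: "\<And>i. i \<in> I \<Longrightarrow> a i \<noteq> 0"
    and ny: "node_poly I y = node_poly I x + smult t (prony_direction I a x)"
    and deg: "degree p \<le> 2 * card I - 1" and I0: "I \<noteq> {}"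
  shows "(\<Sum>j\<in>I. quadrature_weight I a x y j * poly p (y j)) =
      (\<Sum>i\<in>I. a i * poly p (x i)) - t * coeff p (2 * card I - 1)"
proof -
  define q where "q = p div node_poly I y"
  define r where "r = p mod node_poly I y"
  have p: "p = node_poly I y * q + r"
    by (simp add: q_def r_def)
  have card: "card I > 0"
    using I I0 by (simp add: card_gt_0_iff)
  have r: "degree r < card I"
    using degree_mod_less[of "node_poly I y" p] card node_poly_nonzero[of I y]
    by (auto simp: r_def degree_node_poly)
  have q: "degree q < card I"
  proof (cases "q = 0")
    case False
    then have "degree (node_poly I y * q) = card I + degree q"
      by (simp add: degree_mult_eq node_poly_nonzero degree_node_poly)
    moreover have "degree (node_poly I y * q) \<le> 2 * card I - 1"
    proof -
      have "node_poly I y * q = p - r"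
        by (simp add: p)
      then show ?thesis
        using degree_diff_le[of p "2 * card I - 1" r] deg r by simp
    qed
    ultimately show ?thesis
      using card by linarith
  qed (use card in simp)
  \<comment> \<open>The divisor is monic of degree \<open>card I\<close> and the remainder has too
    low a degree to contribute. If the quotient has degree below \<open>card I - 1\<close>, both
    coefficients vanish.\<close>
  have coeff: "coeff p (2 * card I - 1) = coeff q (card I - 1)"
  proof (cases "degree q = card I - 1")
    case True
    have "coeff (node_poly I y * q) (card I + degree q) = coeff q (card I - 1)"
      using coeff_mult_degree_sum[of "node_poly I y" q] True
      by (simp add: degree_node_poly coeff_node_poly_card)
    moreover have "coeff r (card I + degree q) = 0"
      using r by (intro coeff_eq_0) simp
    moreover have "card I + degree q = 2 * card I - 1"
      using True card by simp
    ultimately show ?thesis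
      by (simp add: p)
  next
    case False
    then have "degree (node_poly I y * q) < 2 * card I - 1"
      using degree_mult_le[of "node_poly I y" q] q by (simp add: degree_node_poly)
    then have "coeff p (2 * card I - 1) = 0"
      using r by (simp add: p coeff_eq_0)
    moreover have "coeff q (card I - 1) = 0"
      using False q by (intro coeff_eq_0) simp
    ultimately show ?thesis
      by simp
  qed
  have "(\<Sum>j\<in>I. quadrature_weight I a x y j * poly p (y j)) =
      (\<Sum>j\<in>I. quadrature_weight I a x y j * poly r (y j))"
    using I by (intro sum.cong) (simp_all add: p poly_node_poly_node)
  also have "\<dots> = (\<Sum>i\<in>I. a i * poly r (x i))"
    by (rule quadrature_low_degree[OF I y r])
  also have "\<dots> = (\<Sum>i\<in>I. a i * poly p (x i)) - (\<Sum>i\<in>I. a i * poly (node_poly I y) (x i) * poly q (x i))"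
    by (simp add: p sum_subtractf[symmetric] algebra_simps)
  \<comment> \<open>At \<open>x i\<close> only the perturbation term of \<open>node_poly I y\<close>
    survives; its factor \<open>1 / a i\<close> cancels the amplitude and leaves a divided
    difference.\<close>
  also have "(\<Sum>i\<in>I. a i * poly (node_poly I y) (x i) * poly q (x i)) =
      (\<Sum>i\<in>I. t * (poly q (x i) / lagrange_weight I x i))"
    using I a by (intro sum.cong)
      (simp_all add: ny poly_node_poly_node poly_prony_direction_node)
  also have "\<dots> = t * coeff p (2 * card I - 1)"
    by (simp only: sum_distrib_left[symmetric] divided_difference_eq_coeff[OF I x q] coeff)
  finally show ?thesis .
qed

text \<open>Test the equality of moments on the product of all \<open>(z - x i) * (z - y i)\<close> with \<open>i \<noteq> j\<close>.\<close>

lemma amplitude_ratio: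
  fixes a :: "'i \<Rightarrow> 'a::field"
  assumes I: "finite I" and j: "j \<in> I"
    and eq: "\<And>p. degree p \<le> 2 * card I - 2 \<Longrightarrow>
      (\<Sum>i\<in>I. b i * poly p (y i)) = (\<Sum>i\<in>I. a i * poly p (x i))"
  shows "b j * (\<Prod>i\<in>I - {j}. (y j - x i) * (y j - y i)) =
    a j * (\<Prod>i\<in>I - {j}. (x j - x i) * (x j - y i))"
proof -
  define p where "p = node_poly (I - {j}) x * node_poly (I - {j}) y"
  have "degree p \<le> 2 * card I - 2"
    using I j by (simp add: p_def degree_mult_eq node_poly_nonzero degree_node_poly)
  note eq[OF this]
  moreover have "poly p (y i) = 0" "poly p (x i) = 0" if "i \<in> I" "i \<noteq> j" for i
    using that I by (simp_all add: p_def poly_node_poly_node)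
  then have "(\<Sum>i\<in>I. b i * poly p (y i)) = (\<Sum>i\<in>I. if i = j then b j * poly p (y j) else 0)"
    "(\<Sum>i\<in>I. a i * poly p (x i)) = (\<Sum>i\<in>I. if i = j then a j * poly p (x j) else 0)"
    by (auto intro: sum.cong)
  ultimately show ?thesis
    using I j by (simp add: p_def poly_node_poly prod.distrib)
qed

section \<open>Roots of the perturbed node polynomial\<close>

text \<open>At both points \<open>x j - r\<close> and \<open>x j + r\<close> the perturbation is too
  small to alter the sign of the node polynomial, which differs between them; the intermediate value
  theorem applies.\<close>

lemma root_of_perturbed_node_poly:
  fixes x :: "'i \<Rightarrow> real"
  assumes I: "finite I" and j: "j \<in> I" and r: "r > 0"
    and sep: "\<And>i. i \<in> I \<Longrightarrow> i \<noteq> j \<Longrightarrow> 2 * r \<le> \<bar>x j - x i\<bar>"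
    and bound: "\<And>z. \<bar>z - x j\<bar> = r \<Longrightarrow> \<bar>poly p z\<bar> < r ^ card I"
  shows "\<exists>z. \<bar>z - x j\<bar> < r \<and> poly (node_poly I x + p) z = 0"
proof -
  define Q where "Q = poly (node_poly I x)"
  have large: "r ^ card I \<le> \<bar>Q z\<bar>" if "\<bar>z - x j\<bar> = r" for z
  proof -
    have "(\<Prod>i\<in>I. r) \<le> (\<Prod>i\<in>I. \<bar>z - x i\<bar>)"
    proof (rule prod_mono)
      fix i assume "i \<in> I"
      then show "0 \<le> r \<and> r \<le> \<bar>z - x i\<bar>"
        using sep[of i] that r by (cases "i = j") auto
    qed
    then show ?thesis
      by (simp add: Q_def poly_node_poly abs_prod)
  qed
  \<comment> \<open>Pairing the factors at the two points gives a difference of squares for each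
    \<open>i\<close>: negative for \<open>i = j\<close>, positive otherwise.\<close>
  have "Q (x j - r) * Q (x j + r) = - r\<^sup>2 * (\<Prod>i\<in>I - {j}. (x j - x i)\<^sup>2 - r\<^sup>2)"
  proof -
    have "Q (x j - r) * Q (x j + r) = (\<Prod>i\<in>I. (x j - x i)\<^sup>2 - r\<^sup>2)"
      by (simp add: Q_def poly_node_poly prod.distrib[symmetric] power2_eq_square algebra_simps)
    then show ?thesis
      using prod.remove[OF I j, of "\<lambda>i. (x j - x i)\<^sup>2 - r\<^sup>2"] by simp
  qed
  moreover have "0 < (\<Prod>i\<in>I - {j}. (x j - x i)\<^sup>2 - r\<^sup>2)"
  proof (rule prod_pos)
    fix i assume "i \<in> I - {j}"
    then have "\<bar>r\<bar> < \<bar>x j - x i\<bar>"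
      using sep[of i] r by auto
    then show "0 < (x j - x i)\<^sup>2 - r\<^sup>2"
      using power2_strict_mono by force
  qed
  ultimately have "Q (x j - r) * Q (x j + r) < 0"
    using r by simp
  moreover have "\<bar>poly p (x j - r)\<bar> < \<bar>Q (x j - r)\<bar>" "\<bar>poly p (x j + r)\<bar> < \<bar>Q (x j + r)\<bar>"
    using bound[of "x j - r"] large[of "x j - r"] bound[of "x j + r"] large[of "x j + r"] r by auto
  ultimately have "(Q (x j - r) + poly p (x j - r)) * (Q (x j + r) + poly p (x j + r)) < 0"
    unfolding mult_less_0_iff by linarith
  then obtain z where "x j - r < z" "z < x j + r" "poly (node_poly I x + p) z = 0"
    using r poly_IVT[of "x j - r" "x j + r" "node_poly I x + p"] by (auto simp: Q_def)
  then show ?thesis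
    by (intro exI[of _ z]) (simp add: abs_less_iff)
qed

text \<open>Both sides are monic of degree \<open>card I\<close> and share the \<open>card I\<close>
  distinct roots \<open>y i\<close>.\<close>

lemma node_poly_eqI:
  fixes x :: "'i \<Rightarrow> 'a::field"
  assumes "finite I" "inj_on y I" "degree p < card I"
    and "\<And>i. i \<in> I \<Longrightarrow> poly (node_poly I x + p) (y i) = 0"
  shows "node_poly I y = node_poly I x + p"
proof (rule poly_eqI_degree_lead_coeff[of _ "card I" _ "y ` I"])
  show "coeff (node_poly I y) (card I) = coeff (node_poly I x + p) (card I)"
    using assms(3) by (simp add: coeff_node_poly_card coeff_eq_0)
  show "degree (node_poly I x + p) \<le> card I"
    using assms(3) by (intro degree_add_le) (simp_all add: degree_node_poly)
qed (use assms in \<open>auto simp: card_image degree_node_poly poly_node_poly_node\<close>)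

section \<open>Quantitative perturbation of a cluster\<close>

text \<open>All factors are positive and shrink when \<open>z\<close> moves right to
  \<open>z'\<close>, so the ratio of the products is at least the ratio of the single factor
  belonging to \<open>x k\<close>. It later turns a node shift into an amplitude shift.\<close>

lemma prod_diff_ratio:
  fixes x y :: "'i \<Rightarrow> real"
  assumes J: "finite J" "k \<in> J" and z: "z \<le> z'"
    and less: "\<And>i. i \<in> J \<Longrightarrow> z' < x i" "\<And>i. i \<in> J \<Longrightarrow> z' < y i"
  shows "(\<Prod>i\<in>J. (x i - z') * (y i - z')) * (x k - z) \<le> (\<Prod>i\<in>J. (x i - z) * (y i - z)) * (x k - z')"
proof -
  define f where "f = (\<lambda>i w. (x i - w) * (y i - w))"
  have "(\<Prod>i\<in>J - {k}. f i z') \<le> (\<Prod>i\<in>J - {k}. f i z)"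
    using z less by (intro prod_mono) (fastforce simp: f_def intro!: mult_mono)
  moreover have "0 \<le> (\<Prod>i\<in>J - {k}. f i z')"
    using less by (intro prod_nonneg) (auto simp: f_def intro!: mult_nonneg_nonneg less_imp_le)
  moreover have "y k - z' \<le> y k - z" "0 \<le> y k - z'"
    using z less(2)[OF J(2)] by auto
  ultimately have "(y k - z') * (\<Prod>i\<in>J - {k}. f i z') \<le> (y k - z) * (\<Prod>i\<in>J - {k}. f i z)"
    by (intro mult_mono) auto
  then have "(x k - z) * (x k - z') * ((y k - z') * (\<Prod>i\<in>J - {k}. f i z')) \<le>
      (x k - z) * (x k - z') * ((y k - z) * (\<Prod>i\<in>J - {k}. f i z))"
    using z less(1)[OF J(2)] by (intro mult_left_mono) auto
  then show ?thesis
    using prod.remove[OF J, of "\<lambda>i. f i z"] prod.remove[OF J, of "\<lambda>i. f i z'"]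
    by (simp add: f_def mult_ac)
qed

text \<open>The hypotheses see only differences of nodes, so the constants do not depend on the
  center. The last two conclusions bound from below the shifts of the first node and the first
  amplitude.\<close>

lemma cluster_perturbation:
  fixes a x :: "nat \<Rightarrow> real" and d :: nat
  assumes d: "d \<ge> 2" and h: "h > 0" and \<eta>: "\<eta> > 0" and m: "m > 0" and \<epsilon>: "\<epsilon> > 0"
    and sep: "\<And>i j. i \<in> {1..d} \<Longrightarrow> j \<in> {1..d} \<Longrightarrow> i < j \<Longrightarrow> \<eta> * h \<le> x j - x i"
    and diam: "\<And>i j. i \<in> {1..d} \<Longrightarrow> j \<in> {1..d} \<Longrightarrow> \<bar>x j - x i\<bar> \<le> 2 * h"
    and amp: "\<And>j. j \<in> {1..d} \<Longrightarrow> m \<le> \<bar>a j\<bar> \<and> \<bar>a j\<bar> \<le> M"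
    and small: "\<epsilon> \<le> m * (\<eta> / 3) ^ d * \<eta> ^ (2 * (d - 1)) / (2 * real d * 3 ^ (d - 1)) * h ^ (2 * d - 1)"
  obtains b y where "strict_mono_on {1..d} y" "\<And>j. j \<in> {1..d} \<Longrightarrow> b j \<noteq> 0"
    "\<And>k. k \<le> 2 * d - 1 \<Longrightarrow> \<bar>(\<Sum>j=1..d. b j * y j ^ k) - (\<Sum>j=1..d. a j * x j ^ k)\<bar> \<le> \<epsilon>"
    "\<epsilon> \<le> M * 6 ^ (d - 1) * h ^ (2 * (d - 1)) * \<bar>y 1 - x 1\<bar>"
    "m * \<bar>y 1 - x 1\<bar> \<le> 3 * h * \<bar>b 1 - a 1\<bar>"
proof -
  define I where "I = {1..d}"
  define n where "n = d - 1"
  define r where "r = \<eta> * h / 3"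
  define P where "P = prony_direction I a x"
  have dn: "d = Suc n" "2 * d - 1 = 2 * n + 1" "2 * (d - 1) = 2 * n" "d - 1 = n" and n: "n \<ge> 1"
    using d by (auto simp: n_def)
  have I: "finite I" "card I = d" "card (I - {j}) = n" "1 \<in> I" "2 \<in> I" if "j \<in> I" for j
    using d that by (auto simp: I_def n_def)
  have finI: "finite I" and cardI: "card I = d" and I1: "1 \<in> I" "2 \<in> I"
    using d by (auto simp: I_def)
  have r: "r > 0" "3 * r = \<eta> * h"
    using h \<eta> by (simp_all add: r_def)
  have sep': "3 * r \<le> \<bar>x j - x i\<bar>" if "i \<in> I" "j \<in> I" "i \<noteq> j" for i j
    using sep[of i j] sep[of j i] that r unfolding I_def by (cases "i < j") auto
  \<comment> \<open>Hence a point within \<open>r\<close> of some node is within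
    \<open>3 * h\<close> of every node, which explains the factors \<open>3 * h\<close>
    below.\<close>
  have rh: "r \<le> h"
    using sep'[of 1 2] diam[of 1 2] I1 h by (auto simp: I_def)
  have inj_x: "inj_on x I"
    using sep' r by (fastforce simp: inj_on_def)
  have a0: "a j \<noteq> 0" if "j \<in> I" for j
    using amp[of j] that m by (auto simp: I_def)
  have w_lower: "(\<eta> * h) ^ n \<le> \<bar>lagrange_weight I x j\<bar>" if "j \<in> I" for j
  proof -
    have "(\<Prod>i\<in>I - {j}. \<eta> * h) \<le> (\<Prod>i\<in>I - {j}. \<bar>x j - x i\<bar>)"
      using sep' that r h \<eta> by (intro prod_mono) auto
    then show ?thesis
      using I(3)[OF that] by (simp add: lagrange_weight_def poly_node_poly abs_prod)
  qed
  have w_upper: "\<bar>lagrange_weight I x j\<bar> \<le> (2 * h) ^ n" if "j \<in> I" for j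
  proof -
    have "(\<Prod>i\<in>I - {j}. \<bar>x j - x i\<bar>) \<le> (\<Prod>i\<in>I - {j}. 2 * h)"
      using diam that by (intro prod_mono) (auto simp: I_def)
    then show ?thesis
      using I(3)[OF that] by (simp add: lagrange_weight_def poly_node_poly abs_prod)
  qed
  have P_bound: "\<bar>poly P z\<bar> \<le> d * ((3 * h) ^ n / (m * ((\<eta> * h) ^ n)\<^sup>2))"
    if "j \<in> I" "\<bar>z - x j\<bar> = r" for j z
  proof -
    have "\<bar>poly P z\<bar> \<le> (\<Sum>i\<in>I. \<bar>1 / (a i * (lagrange_weight I x i)\<^sup>2) * (\<Prod>k\<in>I - {i}. z - x k)\<bar>)"
      unfolding P_def prony_direction_def poly_sum poly_smult poly_node_poly by (rule sum_abs)
    also have "\<dots> \<le> (\<Sum>i\<in>I. (3 * h) ^ n / (m * ((\<eta> * h) ^ n)\<^sup>2))"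
    proof (rule sum_mono)
      fix i assume i: "i \<in> I"
      have "(\<Prod>k\<in>I - {i}. \<bar>z - x k\<bar>) \<le> (\<Prod>k\<in>I - {i}. 3 * h)"
      proof (rule prod_mono)
        fix k assume "k \<in> I - {i}"
        then show "0 \<le> \<bar>z - x k\<bar> \<and> \<bar>z - x k\<bar> \<le> 3 * h"
          using diam[of k j] that rh by (auto simp: I_def)
      qed
      then have "\<bar>\<Prod>k\<in>I - {i}. z - x k\<bar> \<le> (3 * h) ^ n"
        using I(3)[OF i] by (simp add: abs_prod)
      moreover have "m * ((\<eta> * h) ^ n)\<^sup>2 \<le> \<bar>a i\<bar> * \<bar>lagrange_weight I x i\<bar>\<^sup>2"
        using amp[of i] w_lower[OF i] i m h \<eta> by (intro mult_mono power_mono) (auto simp: I_def)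
      moreover have "m * ((\<eta> * h) ^ n)\<^sup>2 > 0"
        using m h \<eta> by simp
      ultimately have "\<bar>\<Prod>k\<in>I - {i}. z - x k\<bar> / (\<bar>a i\<bar> * \<bar>lagrange_weight I x i\<bar>\<^sup>2) \<le>
          (3 * h) ^ n / (m * ((\<eta> * h) ^ n)\<^sup>2)"
        by (intro frac_le) auto
      then show "\<bar>1 / (a i * (lagrange_weight I x i)\<^sup>2) * (\<Prod>k\<in>I - {i}. z - x k)\<bar>
          \<le> (3 * h) ^ n / (m * ((\<eta> * h) ^ n)\<^sup>2)"
        by (simp add: abs_mult)
    qed
    finally show ?thesis
      by (simp add: cardI)
  qed
  have "\<exists>z. \<bar>z - x j\<bar> < r \<and> poly (node_poly I x + smult \<epsilon> P) z = 0" if j: "j \<in> I" for j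
  proof (rule root_of_perturbed_node_poly[OF finI j r(1)])
    show "2 * r \<le> \<bar>x j - x i\<bar>" if "i \<in> I" "i \<noteq> j" for i
      using sep'[of i j] that j r by auto
    fix z assume z: "\<bar>z - x j\<bar> = r"
    have "\<bar>poly (smult \<epsilon> P) z\<bar> \<le> \<epsilon> * (d * ((3 * h) ^ n / (m * ((\<eta> * h) ^ n)\<^sup>2)))"
      using mult_left_mono[OF P_bound[OF j z], of \<epsilon>] \<epsilon> by (simp add: abs_mult)
    also have "\<dots> \<le> (m * (\<eta> / 3) ^ d * \<eta> ^ (2 * n) / (2 * real d * 3 ^ n) * h ^ (2 * n + 1))
        * (d * ((3 * h) ^ n / (m * ((\<eta> * h) ^ n)\<^sup>2)))"
      using small m h \<eta> by (intro mult_right_mono) (simp_all add: dn)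
    \<comment> \<open>The constant in \<open>small\<close> is chosen for this identity. The bound on
      \<open>P\<close> scales like \<open>h ^ n / h ^ (2 * n)\<close> and \<open>r ^ d\<close> like
      \<open>h ^ (n + 1)\<close>, whence the exponent \<open>2 * n + 1\<close>; the factor 2 yields
      strictness.\<close>
    also have "\<dots> = r ^ card I / 2"
    proof -
      define A where "A = h ^ n"
      define B where "B = \<eta> ^ n"
      define R where "R = (\<eta> / 3) ^ d"
      define T where "T = (3::real) ^ n"
      have pos: "A > 0" "B > 0" "T > 0" "real d > 0"
        using h \<eta> d by (simp_all add: A_def B_def T_def)
      have eqs: "h ^ (2 * n + 1) = A * A * h" "\<eta> ^ (2 * n) = B * B"
        "(3 * h) ^ n = T * A" "(\<eta> * h) ^ n = B * A" "r ^ card I = R * (A * h)"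
        by (simp_all add: A_def B_def R_def T_def r_def cardI power_mult_distrib power_add
            power_divide dn(1) mult_2)
      show ?thesis
        unfolding eqs R_def[symmetric] T_def[symmetric]
        using m h pos by (simp add: power2_eq_square)
    qed
    also have "\<dots> < r ^ card I"
      using r by simp
    finally show "\<bar>poly (smult \<epsilon> P) z\<bar> < r ^ card I" .
  qed
  then obtain y where y: "\<And>j. j \<in> I \<Longrightarrow> \<bar>y j - x j\<bar> < r"
    and root: "\<And>j. j \<in> I \<Longrightarrow> poly (node_poly I x + smult \<epsilon> P) (y j) = 0"
    by metis
  \<comment> \<open>The intervals of radius \<open>r\<close> around the nodes are disjoint, so the
    chosen roots keep the order of the nodes and exhaust the roots of the perturbed
    polynomial.\<close>
  have mono_y: "strict_mono_on I y"
  proof (rule strict_mono_onI)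
    fix i j assume ij: "i \<in> I" "j \<in> I" "i < j"
    then show "y i < y j"
      using sep[of i j] y[of i] y[of j] r by (auto simp: I_def)
  qed
  then have inj_y: "inj_on y I"
    by (rule strict_mono_on_imp_inj_on)
  have "degree (smult \<epsilon> P) < card I"
    using degree_sum_node_poly[OF finI, of "\<lambda>j. 1 / (a j * (lagrange_weight I x j)\<^sup>2)" x] d
      degree_smult_le[of \<epsilon> P] by (simp add: P_def prony_direction_def cardI)
  then have ny: "node_poly I y = node_poly I x + smult \<epsilon> P"
    by (rule node_poly_eqI[OF finI inj_y _ root])
  define b where "b = quadrature_weight I a x y"
  have quad: "(\<Sum>j\<in>I. b j * poly p (y j)) = (\<Sum>i\<in>I. a i * poly p (x i)) - \<epsilon> * coeff p (2 * d - 1)"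
    if "degree p \<le> 2 * d - 1" for p
    using quadrature_prony_direction[OF finI inj_x inj_y a0 ny[unfolded P_def], of p] that I1(1)
    by (auto simp: b_def cardI)
  have ratio: "b j * (\<Prod>i\<in>I - {j}. (y j - x i) * (y j - y i)) =
      a j * (\<Prod>i\<in>I - {j}. (x j - x i) * (x j - y i))" if "j \<in> I" for j
  proof (rule amplitude_ratio[OF finI that])
    fix p :: "real poly" assume "degree p \<le> 2 * card I - 2"
    then have "degree p \<le> 2 * d - 1" "coeff p (2 * d - 1) = 0"
      using d by (auto simp: cardI coeff_eq_0)
    then show "(\<Sum>i\<in>I. b i * poly p (y i)) = (\<Sum>i\<in>I. a i * poly p (x i))"
      using quad[of p] by simp
  qed
  have b0: "b j \<noteq> 0" if "j \<in> I" for j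
  proof -
    \<comment> \<open>The separation keeps \<open>x j\<close> away from every other old or new node,
      so the right side of \<open>ratio\<close> is nonzero.\<close>
    have "(\<Prod>i\<in>I - {j}. (x j - x i) * (x j - y i)) \<noteq> 0"
    proof -
      have "x j - x i \<noteq> 0 \<and> x j - y i \<noteq> 0" if "i \<in> I - {j}" for i
        using sep'[of i j] y[of i] that \<open>j \<in> I\<close> r by auto
      then show ?thesis
        using finI by simp
    qed
    then show ?thesis
      using ratio[OF that] a0[OF that] by auto
  qed
  \<comment> \<open>For \<open>monom 1 k\<close> the defect is 0 when \<open>k < 2 * d - 1\<close>
    and \<open>-\<epsilon>\<close> when \<open>k = 2 * d - 1\<close>.\<close>
  have moments: "\<bar>(\<Sum>j=1..d. b j * y j ^ k) - (\<Sum>j=1..d. a j * x j ^ k)\<bar> \<le> \<epsilon>" if "k \<le> 2 * d - 1" for k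
    using quad[of "monom 1 k"] that \<epsilon> by (auto simp: poly_monom degree_monom_eq I_def)
  \<comment> \<open>Evaluate the new node polynomial at \<open>x 1\<close>. The factors away from
    \<open>y 1\<close> are at most \<open>3 * h\<close> and the weight at most
    \<open>(2 * h) ^ n\<close>; together they give \<open>6 ^ n * h ^ (2 * n)\<close>.\<close>
  have node: "\<epsilon> \<le> M * 6 ^ n * h ^ (2 * n) * \<bar>y 1 - x 1\<bar>"
  proof -
    have "(\<Prod>i\<in>I - {1}. \<bar>x 1 - y i\<bar>) \<le> (\<Prod>i\<in>I - {1}. 3 * h)"
    proof (rule prod_mono)
      fix i assume "i \<in> I - {1}"
      then show "0 \<le> \<bar>x 1 - y i\<bar> \<and> \<bar>x 1 - y i\<bar> \<le> 3 * h"
        using diam[of i 1] y[of i] rh I1 by (auto simp: I_def)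
    qed
    then have far: "(\<Prod>i\<in>I - {1}. \<bar>x 1 - y i\<bar>) \<le> (3 * h) ^ n"
      using I(3)[OF I1(1)] by simp
    have "poly (node_poly I y) (x 1) = \<epsilon> / (a 1 * lagrange_weight I x 1)"
      by (simp only: ny P_def poly_add poly_smult poly_node_poly_node[OF finI I1(1)]
          poly_prony_direction_node[OF finI I1(1)] add_0 times_divide_eq_right mult_1_right)
    then have "\<epsilon> = (\<Prod>i\<in>I. x 1 - y i) * (a 1 * lagrange_weight I x 1)"
      using a0[OF I1(1)] lagrange_weight_nonzero[OF finI inj_x I1(1)]
      by (simp add: poly_node_poly field_simps)
    then have "\<epsilon> = \<bar>(\<Prod>i\<in>I. x 1 - y i) * (a 1 * lagrange_weight I x 1)\<bar>"
      using \<epsilon> by simp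
    also have "\<dots> = (\<bar>y 1 - x 1\<bar> * (\<Prod>i\<in>I - {1}. \<bar>x 1 - y i\<bar>)) * (\<bar>a 1\<bar> * \<bar>lagrange_weight I x 1\<bar>)"
      using prod.remove[OF finI I1(1), of "\<lambda>i. \<bar>x 1 - y i\<bar>"]
      by (simp add: abs_mult abs_prod abs_minus_commute)
    also have "\<dots> \<le> (\<bar>y 1 - x 1\<bar> * (3 * h) ^ n) * (M * (2 * h) ^ n)"
      using far w_upper[OF I1(1)] amp[of 1] I1 h m
      by (intro mult_mono mult_nonneg_nonneg prod_nonneg) (auto simp: I_def)
    also have "\<dots> = M * 6 ^ n * h ^ (2 * n) * \<bar>y 1 - x 1\<bar>"
    proof -
      have "(6::real) ^ n = 2 ^ n * 3 ^ n" "h ^ (2 * n) = h ^ n * h ^ n"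
        by (simp_all add: power_mult_distrib[symmetric] power_add mult_2)
      then show ?thesis
        by (simp only: power_mult_distrib mult_ac)
    qed
    finally show ?thesis .
  qed
  have amplitude: "m * \<bar>y 1 - x 1\<bar> \<le> 3 * h * \<bar>b 1 - a 1\<bar>"
  proof -
    have "m \<le> \<bar>a 1\<bar>"
      using amp[of 1] I1 by (simp add: I_def)
    \<comment> \<open>Reversing signs in \<open>ratio\<close> for the leftmost node makes all
      factors positive. Then \<open>b 1 / a 1 = v / u\<close>, and it remains to keep
      \<open>v / u\<close> away from 1.\<close>
    define u where "u = (\<Prod>i\<in>I - {1}. (x i - y 1) * (y i - y 1))"
    define v where "v = (\<Prod>i\<in>I - {1}. (x i - x 1) * (y i - x 1))"
    have right: "y 1 < x i" "y 1 < y i" "x 1 < x i" "x 1 < y i" if "i \<in> I - {1}" for i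
      using sep[of 1 i] y[of 1] y[of i] r I1(1) that by (auto simp: I_def)
    have u: "u > 0"
      unfolding u_def using right by (intro prod_pos) auto
    have "b 1 * u = a 1 * v"
      using ratio[OF I1(1)] by (simp add: u_def v_def algebra_simps)
    then have "(b 1 - a 1) * u = a 1 * (v - u)"
      by (simp add: algebra_simps)
    then have diff: "\<bar>b 1 - a 1\<bar> * u = \<bar>a 1\<bar> * \<bar>v - u\<bar>"
      using u by (metis abs_mult abs_of_pos)
    have gap: "0 < x 2 - y 1" "x 2 - y 1 \<le> 3 * h"
      using right(1)[of 2] I1 y[of 1] rh diam[of 1 2] by (auto simp: I_def)
    \<comment> \<open>The direction of the shift decides which of \<open>u\<close> and
      \<open>v\<close> is larger. In both cases the factor of the second node \<open>x 2\<close>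
      alone gives the bound.\<close>
    have "u * \<bar>y 1 - x 1\<bar> \<le> \<bar>v - u\<bar> * (x 2 - y 1)"
    proof (cases "x 1 \<le> y 1")
      case True
      have "u * (x 2 - x 1) \<le> v * (x 2 - y 1)"
        unfolding u_def v_def using finI I1 True right by (intro prod_diff_ratio) auto
      then have "u * (y 1 - x 1) \<le> (v - u) * (x 2 - y 1)"
        by (simp add: algebra_simps)
      also have "\<dots> \<le> \<bar>v - u\<bar> * (x 2 - y 1)"
        using gap by (intro mult_right_mono) auto
      finally show ?thesis
        using True by simp
    next
      case False
      have "v * (x 2 - y 1) \<le> u * (x 2 - x 1)"
        unfolding u_def v_def using finI I1 False right by (intro prod_diff_ratio) auto
      then have "u * (x 1 - y 1) \<le> (u - v) * (x 2 - y 1)"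
        by (simp add: algebra_simps)
      also have "\<dots> \<le> \<bar>v - u\<bar> * (x 2 - y 1)"
        using gap by (intro mult_right_mono) auto
      finally show ?thesis
        using False by simp
    qed
    also have "\<dots> \<le> \<bar>v - u\<bar> * (3 * h)"
      using gap by (intro mult_left_mono) auto
    finally have "u * \<bar>y 1 - x 1\<bar> \<le> \<bar>v - u\<bar> * (3 * h)" .
    then have "m * (u * \<bar>y 1 - x 1\<bar>) \<le> \<bar>a 1\<bar> * (\<bar>v - u\<bar> * (3 * h))"
      using \<open>m \<le> \<bar>a 1\<bar>\<close> u by - (rule mult_mono, auto)
    also have "\<dots> = 3 * h * (\<bar>b 1 - a 1\<bar> * u)"
      unfolding diff by simp
    finally have "u * (m * \<bar>y 1 - x 1\<bar>) \<le> u * (3 * h * \<bar>b 1 - a 1\<bar>)"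
      by (simp add: mult_ac)
    then show ?thesis
      using u by simp
  qed
  show ?thesis
    using that[of y b] mono_y b0 moments node amplitude by (simp add: I_def dn)
qed

section \<open>Lower bounds for the worst case errors\<close>

lemma abs_le_vec_max_norm: "j \<in> {1..d} \<Longrightarrow> \<bar>v j\<bar> \<le> vec_max_norm d v"
  by (simp add: vec_max_norm_def)

theorem theorem6p2:
  fixes d :: nat and \<eta> m M :: real
  assumes "d \<ge> 2" and "\<eta> > 0" and "0 < m" and "m \<le> M"
  shows "\<exists>K3 > 0. \<exists>K4 > 0. \<exists>C6 > 0. \<exists>C7 > 0.
    \<forall>F\<in>signals d. \<forall>h \<kappa>. regular_cluster d h \<kappa> \<eta> m M F \<longrightarrow>
      (\<forall>\<epsilon> > 0. \<epsilon> \<le> C6 * h ^ (2*d-1) \<longrightarrow>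
         ereal (K3 * (1 / ((1 + \<bar>\<kappa>\<bar>) * h)) ^ (2*d-1) * h * \<epsilon>) \<le> rho_x d F \<epsilon>) \<and>
      (\<forall>\<epsilon> > 0. \<epsilon> \<le> C7 * h ^ (2*d-1) \<longrightarrow>
         ereal (K4 * (1 / ((1 + \<bar>\<kappa>\<bar>) * h)) ^ (2*d-1) * \<epsilon>) \<le> rho d F \<epsilon> \<and>
         ereal (K4 * (1 / ((1 + \<bar>\<kappa>\<bar>) * h)) ^ (2*d-1) * \<epsilon>) \<le> rho_a d F \<epsilon>)"
proof -
  define n where "n = d - 1"
  have dn: "d = Suc n" "2 * d - 1 = 2 * n + 1" "2 * (d - 1) = 2 * n" "d - 1 = n"
    using assms(1) by (auto simp: n_def)
  \<comment> \<open>\<open>C\<close> is the constant of \<open>small\<close> and serves as both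
    \<open>C6\<close> and \<open>C7\<close>. \<open>K\<close> comes from the node estimate;
    \<open>K4\<close> is \<open>m / 3 * K\<close>, the factor \<open>m / 3\<close> coming from the
    amplitude estimate.\<close>
  define C where "C = m * (\<eta> / 3) ^ d * \<eta> ^ (2 * (d - 1)) / (2 * real d * 3 ^ (d - 1))"
  define K where "K = 1 / (M * 6 ^ n)"
  have C: "C > 0" and K: "K > 0" and M: "M > 0"
    using assms by (auto simp: C_def K_def)
  have main: "ereal (K * (1 / ((1 + \<bar>\<kappa>\<bar>) * h)) ^ (2*d-1) * h * \<epsilon>) \<le> rho_x d F \<epsilon> \<and>
         ereal (m / 3 * K * (1 / ((1 + \<bar>\<kappa>\<bar>) * h)) ^ (2*d-1) * \<epsilon>) \<le> rho d F \<epsilon> \<and>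
         ereal (m / 3 * K * (1 / ((1 + \<bar>\<kappa>\<bar>) * h)) ^ (2*d-1) * \<epsilon>) \<le> rho_a d F \<epsilon>"
    if F: "F \<in> signals d" and reg: "regular_cluster d h \<kappa> \<eta> m M F"
      and \<epsilon>: "\<epsilon> > 0" "\<epsilon> \<le> C * h ^ (2*d-1)" for F h \<kappa> \<epsilon>
  proof -
    obtain a x where Fax: "F = (a, x)"
      by (cases F)
    have mono: "strict_mono_on {1..d} x"
      using F by (simp add: Fax signals_def)
    have le: "x i \<le> x j" if "i \<in> {1..d}" "j \<in> {1..d}" "i \<le> j" for i j
      using strict_mono_onD[OF mono, of i j] that by (cases "i = j") auto
    have hdef: "2 * h = x d - x 1"
      using reg by (simp add: Fax regular_cluster_def cluster_h_def)
    have h: "h > 0"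
      using strict_mono_onD[OF mono, of 1 d] assms(1) hdef by simp
    have sep: "\<eta> * h \<le> x j - x i" if "i \<in> {1..d}" "j \<in> {1..d}" "i < j" for i j
    proof -
      have "\<eta> * h \<le> x (i + 1) - x i"
        using reg that by (auto simp: Fax regular_cluster_def)
      moreover have "x (i + 1) \<le> x j"
        using that by (intro le) auto
      ultimately show ?thesis
        by simp
    qed
    have diam: "\<bar>x j - x i\<bar> \<le> 2 * h" if "i \<in> {1..d}" "j \<in> {1..d}" for i j
      using le[of 1 i] le[of 1 j] le[of i d] le[of j d] that hdef by auto
    have amp: "m \<le> \<bar>a j\<bar> \<and> \<bar>a j\<bar> \<le> M" if "j \<in> {1..d}" for j
      using reg that by (auto simp: Fax regular_cluster_def)
    obtain b y where mono_y: "strict_mono_on {1..d} y" and b0: "\<And>j. j \<in> {1..d} \<Longrightarrow> b j \<noteq> 0"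
      and mom: "\<And>k. k \<le> 2 * d - 1 \<Longrightarrow> \<bar>(\<Sum>j=1..d. b j * y j ^ k) - (\<Sum>j=1..d. a j * x j ^ k)\<bar> \<le> \<epsilon>"
      and node: "\<epsilon> \<le> M * 6 ^ (d - 1) * h ^ (2 * (d - 1)) * \<bar>y 1 - x 1\<bar>"
      and amplitude: "m * \<bar>y 1 - x 1\<bar> \<le> 3 * h * \<bar>b 1 - a 1\<bar>"
      by (rule cluster_perturbation[where a = a and x = x and M = M, OF assms(1) h assms(2,3) \<epsilon>(1) _ _ _ \<epsilon>(2)[unfolded C_def]])
        (use sep diam amp that in blast)+
    \<comment> \<open>Restriction supplies the value \<open>undefined\<close> outside
      \<open>{1..d}\<close> that \<open>signals\<close> demands.\<close>
    define F' where "F' = (restrict b {1..d}, restrict y {1..d})"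
    have F': "F' \<in> error_set d \<epsilon> F"
      using mono_y b0 mom by (auto simp: F'_def Fax error_set_def signals_def moment_def strict_mono_on_def)
    have "\<bar>y 1 - x 1\<bar> \<le> vec_max_norm d (snd F' - snd F)"
      using abs_le_vec_max_norm[of 1 d "snd F' - snd F"] assms(1) by (simp add: F'_def Fax)
    then have x: "ereal \<bar>y 1 - x 1\<bar> \<le> rho_x d F \<epsilon>"
      unfolding rho_x_def by (intro SUP_upper2[OF F']) simp
    have v: "\<bar>b 1 - a 1\<bar> \<le> vec_max_norm d (fst F' - fst F)"
      using abs_le_vec_max_norm[of 1 d "fst F' - fst F"] assms(1) by (simp add: F'_def Fax)
    then have a: "ereal \<bar>b 1 - a 1\<bar> \<le> rho_a d F \<epsilon>"
      unfolding rho_a_def by (intro SUP_upper2[OF F']) simp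
    have b: "ereal \<bar>b 1 - a 1\<bar> \<le> rho d F \<epsilon>"
      unfolding rho_def using v by (intro SUP_upper2[OF F']) (simp add: max_norm_def le_max_iff_disj)
    have "h \<le> (1 + \<bar>\<kappa>\<bar>) * h"
      using h by (simp add: distrib_right)
    then have "(1 / ((1 + \<bar>\<kappa>\<bar>) * h)) ^ (2*d-1) \<le> (1 / h) ^ (2*d-1)"
      using h by (intro power_mono frac_le) auto
    then have "K * (1 / ((1 + \<bar>\<kappa>\<bar>) * h)) ^ (2*d-1) * h * \<epsilon> \<le> K * (1 / h) ^ (2*d-1) * h * \<epsilon>"
      using K h \<epsilon> by (intro mult_left_mono mult_right_mono) auto
    \<comment> \<open>The extra factor \<open>h\<close> lowers the exponent \<open>2 * n + 1\<close>
      to the \<open>2 * n\<close> of the node estimate.\<close>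
    also have "\<dots> = \<epsilon> / (M * 6 ^ n * h ^ (2 * n))"
      unfolding dn(2) using h by (simp add: K_def power_one_over field_simps)
    also have "\<dots> \<le> \<bar>y 1 - x 1\<bar>"
      using node h M by (simp add: dn divide_le_eq mult_ac)
    finally have lower: "K * (1 / ((1 + \<bar>\<kappa>\<bar>) * h)) ^ (2*d-1) * h * \<epsilon> \<le> \<bar>y 1 - x 1\<bar>" .
    then have "m * (K * (1 / ((1 + \<bar>\<kappa>\<bar>) * h)) ^ (2*d-1) * h * \<epsilon>) \<le> 3 * h * \<bar>b 1 - a 1\<bar>"
      using amplitude assms(3) mult_left_mono[OF lower, of m] by linarith
    \<comment> \<open>Cancelling \<open>h\<close> here is the gain of \<open>1 / h\<close> of the
      amplitude over the node.\<close>
    then have "h * (m / 3 * K * (1 / ((1 + \<bar>\<kappa>\<bar>) * h)) ^ (2*d-1) * \<epsilon>) \<le> h * \<bar>b 1 - a 1\<bar>"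
      by (simp only: mult_ac times_divide_eq_right times_divide_eq_left divide_le_eq_numeral1)
    then have "m / 3 * K * (1 / ((1 + \<bar>\<kappa>\<bar>) * h)) ^ (2*d-1) * \<epsilon> \<le> \<bar>b 1 - a 1\<bar>"
      using h mult_le_cancel_left_pos by blast
    then show ?thesis
      using lower x a b by (meson ereal_less_eq(3) order_trans)
  qed
  show ?thesis
    using main K C assms(3)
    by (intro exI[of _ K] exI[of _ "m / 3 * K"] exI[of _ C] conjI) auto
qed

end
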